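(* Let $m\ge1$ be an integer. For each $l=1,\dots,m$ let $\mathbb{T}_l$ be a time scale, let $\alpha_l<\beta_l$ be points of $\mathbb{T}_l$, and let $\psi_l,\phi_l:[\alpha_l,\beta_l]_{\mathbb{T}_l}\to(0,\infty)$ be functions such that the Delta integrals below converge. If $\psi_l/\phi_l$ is increasing for all $l=1,\dots,m$ (respectively, decreasing for all $l=1,\dots,m$), then the function $$s\mapsto\frac{\prod_{l=1}^m \int_{\alpha_l}^{\beta_l}\psi_l(\upsilon)s^\upsilon\,\Delta_l\upsilon}{\prod_{l=1}^m \int_{\alpha_l}^{\beta_l}\phi_l(\upsilon)s^\upsilon\,\Delta_l\upsilon}$$ is increasing (respectively, decreasing) for $s\in(0,\infty)$.
   Context: A time scale $\mathbb{T}$ is a nonempty closed subset of $\mathbb{R}$, and $[\alpha,\beta]_{\mathbb{T}}=[\alpha,\beta]\cap\mathbb{T}$. The symbol $\int_a^b f(\upsilon)\,\Delta_l\upsilon$ ($a\le b$ in $\mathbb{T}_l$) denotes the standard Delta integral on $\mathbb{T}_l$, i.e. the integral of $f$ over $[a,b)\cap\mathbb{T}_l$ with respect to the Delta measure on $\mathbb{T}_l$, determined by assigning mass $d-c$ to $[c,d)\cap\mathbb{T}_l$ for $c\le d$ in $\mathbb{T}_l$. "Increasing" and "decreasing" are meant in the non-strict sense. *)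

theory Defs
  imports "HOL-Analysis.Analysis"
begin

definition time_scale :: "real set \<Rightarrow> bool" where
  "time_scale T \<longleftrightarrow> closed T \<and> T \<noteq> {}"

text \<open>The half-open intervals do not cover a greatest element of \<open>T\<close>, so the mass of that
  point is left unspecified; no integral over \<open>{a..<b} \<inter> T\<close> with \<open>a\<close> and \<open>b\<close> in \<open>T\<close> sees it.\<close>

definition delta_premeasure :: "real set \<Rightarrow> real measure" where
  "delta_premeasure T =
     extend_measure T {(c, d). c \<in> T \<and> d \<in> T \<and> c \<le> d}
       (\<lambda>(c, d). {c..<d} \<inter> T) (\<lambda>(c, d). ennreal (d - c))"

text \<open>The Lebesgue Delta measure is complete, being obtained by Caratheodory extension.\<close>

definition delta_measure :: "real set \<Rightarrow> real measure" where
  "delta_measure T = completion (delta_premeasure T)"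

definition delta_integrable :: "real set \<Rightarrow> real \<Rightarrow> real \<Rightarrow> (real \<Rightarrow> real) \<Rightarrow> bool" where
  "delta_integrable T a b f \<longleftrightarrow> set_integrable (delta_measure T) ({a..<b} \<inter> T) f"

definition delta_integral :: "real set \<Rightarrow> real \<Rightarrow> real \<Rightarrow> (real \<Rightarrow> real) \<Rightarrow> real" where
  "delta_integral T a b f = set_lebesgue_integral (delta_measure T) ({a..<b} \<inter> T) f"

text \<open>The prescribed masses do extend to a measure.  The witness is the image of Lebesgue measure
  under the map sending \<open>x\<close> to the greatest element of \<open>T\<close> below \<open>x\<close>, restricted to those \<open>x\<close>
  that lie between two points of \<open>T\<close>.\<close>

lemma emeasure_delta_measure:
  assumes T: "time_scale T" and "c \<in> T" "d \<in> T" "c \<le> d"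
  shows "emeasure (delta_measure T) ({c..<d} \<inter> T) = ennreal (d - c)"
proof -
  define X where "X = {x. \<exists>p\<in>T. \<exists>q\<in>T. p \<le> x \<and> x < q}"
  define \<rho> where "\<rho> x = Sup (T \<inter> {..x})" for x :: real
  have bdd: "bdd_above (T \<inter> {..x})" for x by (rule bdd_aboveI[of _ x]) auto
  have cl: "closed (T \<inter> {..x})" for x
    using T by (auto simp: time_scale_def)
  have \<rho>_in: "\<rho> x \<in> T \<and> \<rho> x \<le> x" if "x \<in> X" for x
  proof -
    have "T \<inter> {..x} \<noteq> {}" using that by (auto simp: X_def)
    from closed_contains_Sup[OF this bdd cl] show ?thesis by (auto simp: \<rho>_def)
  qed
  have \<rho>_ge: "p \<le> \<rho> x" if "p \<in> T" "p \<le> x" for p x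
    unfolding \<rho>_def using that by (intro cSup_upper bdd) auto
  have X_conv: "is_interval X"
    unfolding is_interval_1 X_def by (smt (verit, best) mem_Collect_eq)
  have X_meas: "X \<in> sets borel"
    using X_conv by (rule real_interval_borel_measurable)
  have pre: "\<rho> -` ({p..<q} \<inter> T) \<inter> X = {p..<q}" if "p \<in> T" "q \<in> T" for p q
  proof (rule set_eqI)
    fix x
    show "x \<in> \<rho> -` ({p..<q} \<inter> T) \<inter> X \<longleftrightarrow> x \<in> {p..<q}"
    proof
      assume "x \<in> \<rho> -` ({p..<q} \<inter> T) \<inter> X"
      hence "x \<in> X" "p \<le> \<rho> x" "\<rho> x < q" by auto
      thus "x \<in> {p..<q}"
        using \<rho>_in[of x] \<rho>_ge[of q x] that by force
    next
      assume x: "x \<in> {p..<q}"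
      hence xX: "x \<in> X" using that by (auto simp: X_def)
      thus "x \<in> \<rho> -` ({p..<q} \<inter> T) \<inter> X"
        using \<rho>_in[OF xX] \<rho>_ge[of p x] that x by auto
    qed
  qed
  let ?I = "{(c, d). c \<in> T \<and> d \<in> T \<and> c \<le> d}"
  let ?G = "\<lambda>(c, d). {c..<d} \<inter> T"
  define N where "N = sigma T (?G ` ?I)"
  have sets_N: "sets N = sigma_sets T (?G ` ?I)" and space_N: "space N = T"
    unfolding N_def by (auto intro!: sets_measure_of space_measure_of)
  have \<rho>_meas: "\<rho> \<in> measurable (restrict_space lborel X) N"
    unfolding N_def
  proof (rule measurable_measure_of)
    show "?G ` ?I \<subseteq> Pow T" by auto
    show "\<rho> \<in> space (restrict_space lborel X) \<rightarrow> T"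
      using \<rho>_in by (auto simp: space_restrict_space)
    fix A assume "A \<in> ?G ` ?I"
    then obtain p q where pq: "p \<in> T" "q \<in> T" "A = {p..<q} \<inter> T" by auto
    have "\<rho> -` A \<inter> X = {p..<q}" using pre pq by simp
    moreover have "{p..<q} \<subseteq> X" using pq by (auto simp: X_def)
    ultimately show "\<rho> -` A \<inter> space (restrict_space lborel X) \<in> sets (restrict_space lborel X)"
      using X_meas by (simp add: space_restrict_space sets_restrict_space_iff)
  qed
  let ?\<nu> = "emeasure (distr (restrict_space lborel X) N \<rho>)"
  have \<nu>: "?\<nu> ({p..<q} \<inter> T) = ennreal (q - p)" if "p \<in> T" "q \<in> T" "p \<le> q" for p q
  proof -
    have "{p..<q} \<inter> T \<in> sets N"
      unfolding sets_N using that by (intro sigma_sets.Basic) auto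
    moreover have "{p..<q} \<subseteq> X" using that by (auto simp: X_def)
    ultimately show ?thesis
      using \<rho>_meas X_meas pre that
      by (simp add: emeasure_distr space_restrict_space emeasure_restrict_space)
  qed
  have "measure_space (space N) (sets N) ?\<nu>"
    using measure_space[of "distr (restrict_space lborel X) N \<rho>"] by simp
  hence ms: "measure_space T (sigma_sets T (?G ` ?I)) ?\<nu>"
    by (simp add: sets_N space_N)
  have sets_P: "sets (delta_premeasure T) = sigma_sets T (?G ` ?I)"
    unfolding delta_premeasure_def by (intro sets_extend_measure) auto
  have "emeasure (delta_premeasure T) (?G (c, d)) = (\<lambda>(c, d). ennreal (d - c)) (c, d)"
  proof (rule emeasure_extend_measure[OF delta_premeasure_def])
    show "?\<nu> (?G i) = (\<lambda>(c, d). ennreal (d - c)) i" if "i \<in> ?I" for i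
      using that \<nu> by auto
    show "positive (sets (delta_premeasure T)) ?\<nu>"
      "countably_additive (sets (delta_premeasure T)) ?\<nu>"
      using ms by (auto simp: sets_P measure_space_def)
  qed (use assms in auto)
  moreover have "{c..<d} \<inter> T \<in> sets (delta_premeasure T)"
    unfolding sets_P using assms by (intro sigma_sets.Basic) auto
  ultimately show ?thesis
    by (simp add: delta_measure_def)
qed

end

theory Submission
  imports Defs
begin

text \<open>For a single time scale and \<open>0 < s \<le> t\<close>, the claim is Chebyshev's integral inequality for the
  increasing functions \<open>\<psi> / \<phi>\<close> and \<open>x \<mapsto> (t / s) powr x\<close> under the weight \<open>\<phi> x * s powr x\<close>.
  If \<open>c\<close> is the weighted mean of \<open>\<psi> / \<phi>\<close> and \<open>z\<close> is a point where \<open>\<psi> / \<phi> - c\<close> changes sign,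
  then \<open>(\<psi> / \<phi> - c) * ((t / s) powr x - (t / s) powr z) \<ge> 0\<close>; integrating this against the weight
  annihilates the contribution of \<open>z\<close> and leaves the inequality, without a double integral.\<close>

text \<open>The supremum of the points of \<open>A\<close> with \<open>h x \<le> c\<close> serves as
  \<open>z\<close>: a point of \<open>A\<close> to its left lies below some such point, and one to
  its right is not among them. Nothing is claimed at \<open>z\<close> itself, where \<open>h\<close>
  may jump to either side of \<open>c\<close> and which need not belong to \<open>A\<close>.\<close>

lemma mono_on_sign_change:
  fixes h :: "real \<Rightarrow> real"
  assumes mono: "mono_on A h" and sub: "A \<subseteq> {a..b}"
  obtains z where "\<And>x. x \<in> A \<Longrightarrow> x < z \<Longrightarrow> h x \<le> c" "\<And>x. x \<in> A \<Longrightarrow> z < x \<Longrightarrow> c \<le> h x"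
proof (cases "\<exists>x\<in>A. h x \<le> c")
  case False
  then show ?thesis
    \<comment> \<open>No point of \<open>A\<close> lies left of \<open>a\<close>, so the first
      condition is vacuous.\<close>
    using sub by (intro that[of a]) (auto simp: not_le less_imp_le)
next
  case True
  let ?B = "{x \<in> A. h x \<le> c}"
  have ne: "?B \<noteq> {}" using True by auto
  have bdd: "bdd_above ?B" using sub by (intro bdd_aboveI[of _ b]) auto
  show ?thesis
  proof (rule that[of "Sup ?B"])
    fix x assume "x \<in> A" "x < Sup ?B"
    then obtain y where "y \<in> ?B" "x < y"
      using less_cSup_iff[OF ne bdd] by auto
    then show "h x \<le> c"
      using monotone_onD[OF mono \<open>x \<in> A\<close>, of y] by auto
  next
    fix x assume "x \<in> A" "Sup ?B < x"
    then show "c \<le> h x"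
      using cSup_upper[OF _ bdd, of x] by force
  qed
qed

text \<open>The Chebyshev step for an arbitrary measure. In the form without division it asks for a
  positive integral of \<open>g x * s powr x\<close> only at the smaller parameter, where it is the
  denominator of the mean \<open>c\<close>.\<close>

lemma powr_set_integral_cross_mult_le:
  fixes f g :: "real \<Rightarrow> real"
  assumes sub: "A \<subseteq> {a..b}" and g: "\<And>x. x \<in> A \<Longrightarrow> g x > 0"
    and st: "0 < s" "s \<le> t"
    and int: "set_integrable M A (\<lambda>x. f x * s powr x)" "set_integrable M A (\<lambda>x. f x * t powr x)"
      "set_integrable M A (\<lambda>x. g x * s powr x)" "set_integrable M A (\<lambda>x. g x * t powr x)"
    and pos: "(LINT x:A|M. g x * s powr x) > 0"
    and mono: "mono_on A (\<lambda>x. f x / g x)"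
  shows "(LINT x:A|M. f x * s powr x) * (LINT x:A|M. g x * t powr x)
    \<le> (LINT x:A|M. f x * t powr x) * (LINT x:A|M. g x * s powr x)"
proof -
  let ?F = "\<lambda>s. LINT x:A|M. f x * s powr x" and ?G = "\<lambda>s. LINT x:A|M. g x * s powr x"
  define c where "c = ?F s / ?G s"
  obtain z where z: "\<And>x. x \<in> A \<Longrightarrow> x < z \<Longrightarrow> f x / g x \<le> c" "\<And>x. x \<in> A \<Longrightarrow> z < x \<Longrightarrow> c \<le> f x / g x"
    using mono_on_sign_change[OF mono sub, of c] by blast
  define \<gamma> where "\<gamma> = (t / s) powr z"
  have t_eq: "t powr x = s powr x * (t / s) powr x" for x
    using st by (simp add: powr_divide)
  have nonneg: "0 \<le> (f x * t powr x - c * (g x * t powr x)) - \<gamma> * (f x * s powr x - c * (g x * s powr x))"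
    if "x \<in> A" for x
  proof -
    have "0 \<le> (f x / g x - c) * ((t / s) powr x - \<gamma>)"
    proof (cases x z rule: linorder_cases)
      case less
      then show ?thesis
        using z(1)[OF that] st unfolding \<gamma>_def
        by (intro mult_nonpos_nonpos) (auto intro!: powr_mono)
    next
      case greater
      then show ?thesis
        using z(2)[OF that] st unfolding \<gamma>_def
        by (intro mult_nonneg_nonneg) (auto intro!: powr_mono)
    \<comment> \<open>At \<open>x = z\<close> the sign of \<open>f x / g x - c\<close> is unknown,
      but the power factor is zero there.\<close>
    qed (simp add: \<gamma>_def)
    \<comment> \<open>The weight clears the denominator \<open>g x\<close> and, by
      \<open>t_eq\<close>, turns \<open>(t / s) powr x\<close> into \<open>t powr x\<close>, so that
      only the four integrable functions remain.\<close>
    then have "0 \<le> (g x * s powr x) * ((f x / g x - c) * ((t / s) powr x - \<gamma>))"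
      using g[OF that] by (intro mult_nonneg_nonneg[of "g x * s powr x"]) auto
    also have "\<dots> = (f x * t powr x - c * (g x * t powr x)) - \<gamma> * (f x * s powr x - c * (g x * s powr x))"
      using g[OF that] unfolding t_eq by (simp add: field_simps)
    finally show ?thesis .
  qed
  have "0 \<le> (LINT x:A|M. (f x * t powr x - c * (g x * t powr x)) - \<gamma> * (f x * s powr x - c * (g x * s powr x)))"
    unfolding set_lebesgue_integral_def
    using nonneg by (intro integral_nonneg_AE AE_I2) (simp add: indicator_def)
  also have "\<dots> = (?F t - c * ?G t) - \<gamma> * (?F s - c * ?G s)"
    using int by (simp add: set_integral_diff)
  also have "?F s - c * ?G s = 0"
    using pos by (simp add: c_def)
  finally have "c * ?G t \<le> ?F t" by simp
  then show ?thesis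
    using pos by (simp add: c_def field_simps)
qed

text \<open>The domain of integration has mass \<open>b - a > 0\<close>. If the integral were zero,
  the integrand would vanish almost everywhere, and being positive on the whole domain it would
  force that domain to be null.\<close>

lemma delta_integral_pos:
  assumes T: "time_scale T" "a \<in> T" "b \<in> T" "a < b"
    and pos: "\<And>x. x \<in> {a..<b} \<inter> T \<Longrightarrow> f x > 0" and int: "delta_integrable T a b f"
  shows "delta_integral T a b f > 0"
proof -
  let ?A = "{a..<b} \<inter> T" and ?M = "delta_measure T"
  let ?f = "\<lambda>x. indicator ?A x *\<^sub>R f x"
  have em: "emeasure ?M ?A > 0"
    using emeasure_delta_measure[of T a b] T by simp
  \<comment> \<open>\<open>emeasure\<close> takes the default value 0 outside the sigma-algebra, so
    positive mass implies measurability.\<close>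
  then have A: "?A \<in> sets ?M"
    using emeasure_notin_sets by fastforce
  have intf: "integrable ?M ?f"
    using int by (simp add: delta_integrable_def set_integrable_def)
  have nn: "0 \<le> ?f x" for x
    using pos[of x] by (auto simp: indicator_def)
  have "integral\<^sup>L ?M ?f \<noteq> 0"
  proof
    assume "integral\<^sup>L ?M ?f = 0"
    then have "AE x in ?M. ?f x = 0"
      using integral_nonneg_eq_0_iff_AE[OF intf] nn by simp
    then have "AE x in ?M. x \<notin> ?A"
      by eventually_elim (use pos in \<open>force simp: indicator_def\<close>)
    then show False
      using em A by (simp only: AE_iff_null_sets[OF A, symmetric] null_setsD1 less_irrefl)
  qed
  moreover have "integral\<^sup>L ?M ?f \<ge> 0" by (intro integral_nonneg_AE AE_I2 nn)
  ultimately show ?thesis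
    by (simp add: delta_integral_def set_lebesgue_integral_def)
qed

text \<open>The case of one factor: the cross-multiplied inequality over the half-open domain is
  divided by the integrals of \<open>g\<close> at \<open>s\<close> and \<open>t\<close>, both
  positive because \<open>g\<close> is.\<close>

lemma mono_on_delta_integral_powr_ratio:
  assumes T: "time_scale T" "a \<in> T" "b \<in> T" "a < b"
    and g: "\<And>x. x \<in> {a..b} \<inter> T \<Longrightarrow> g x > 0"
    and intf: "\<And>s. s > 0 \<Longrightarrow> delta_integrable T a b (\<lambda>x. f x * s powr x)"
    and intg: "\<And>s. s > 0 \<Longrightarrow> delta_integrable T a b (\<lambda>x. g x * s powr x)"
    and mono: "mono_on ({a..b} \<inter> T) (\<lambda>x. f x / g x)"
  shows "mono_on {0<..} (\<lambda>s::real. delta_integral T a b (\<lambda>x. f x * s powr x) /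
    delta_integral T a b (\<lambda>x. g x * s powr x))"
proof (rule mono_onI)
  fix s t :: real assume st: "s \<in> {0<..}" "t \<in> {0<..}" "s \<le> t"
  have pos: "delta_integral T a b (\<lambda>x. g x * r powr x) > 0" if "r > 0" for r
    using that g intg T by (intro delta_integral_pos) auto
  have mono': "mono_on ({a..<b} \<inter> T) (\<lambda>x. f x / g x)"
    using mono by (rule monotone_on_subset) auto
  have "delta_integral T a b (\<lambda>x. f x * s powr x) * delta_integral T a b (\<lambda>x. g x * t powr x)
    \<le> delta_integral T a b (\<lambda>x. f x * t powr x) * delta_integral T a b (\<lambda>x. g x * s powr x)"
    unfolding delta_integral_def
    by (rule powr_set_integral_cross_mult_le[of _ a b, OF _ _ _ _ _ _ _ _ _ mono'])
       (use st g intf intg pos in \<open>auto simp: delta_integrable_def delta_integral_def\<close>)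
  then show "delta_integral T a b (\<lambda>x. f x * s powr x) / delta_integral T a b (\<lambda>x. g x * s powr x)
    \<le> delta_integral T a b (\<lambda>x. f x * t powr x) / delta_integral T a b (\<lambda>x. g x * t powr x)"
    using pos[of s] pos[of t] st by (simp add: frac_le_eq field_simps)
qed

theorem theorem3p3:
  fixes m :: nat
    and T :: "nat \<Rightarrow> real set"
    and \<alpha> \<beta> :: "nat \<Rightarrow> real"
    and \<psi> \<phi> :: "nat \<Rightarrow> real \<Rightarrow> real"
  assumes "m \<ge> 1"
    and "\<And>l. l \<in> {1..m} \<Longrightarrow> time_scale (T l)"
    and "\<And>l. l \<in> {1..m} \<Longrightarrow> \<alpha> l \<in> T l \<and> \<beta> l \<in> T l \<and> \<alpha> l < \<beta> l"
    and "\<And>l x. l \<in> {1..m} \<Longrightarrow> x \<in> {\<alpha> l..\<beta> l} \<inter> T l \<Longrightarrow> \<psi> l x > 0 \<and> \<phi> l x > 0"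
    and "\<And>l s. l \<in> {1..m} \<Longrightarrow> s > 0 \<Longrightarrow>
           delta_integrable (T l) (\<alpha> l) (\<beta> l) (\<lambda>x. \<psi> l x * s powr x)"
    and "\<And>l s. l \<in> {1..m} \<Longrightarrow> s > 0 \<Longrightarrow>
           delta_integrable (T l) (\<alpha> l) (\<beta> l) (\<lambda>x. \<phi> l x * s powr x)"
  shows "((\<forall>l\<in>{1..m}. mono_on ({\<alpha> l..\<beta> l} \<inter> T l) (\<lambda>x. \<psi> l x / \<phi> l x)) \<longrightarrow>
            mono_on {0<..} (\<lambda>s::real.
              (\<Prod>l=1..m. delta_integral (T l) (\<alpha> l) (\<beta> l) (\<lambda>x. \<psi> l x * s powr x)) /
              (\<Prod>l=1..m. delta_integral (T l) (\<alpha> l) (\<beta> l) (\<lambda>x. \<phi> l x * s powr x)))) \<and>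
         ((\<forall>l\<in>{1..m}. antimono_on ({\<alpha> l..\<beta> l} \<inter> T l) (\<lambda>x. \<psi> l x / \<phi> l x)) \<longrightarrow>
            antimono_on {0<..} (\<lambda>s::real.
              (\<Prod>l=1..m. delta_integral (T l) (\<alpha> l) (\<beta> l) (\<lambda>x. \<psi> l x * s powr x)) /
              (\<Prod>l=1..m. delta_integral (T l) (\<alpha> l) (\<beta> l) (\<lambda>x. \<phi> l x * s powr x))))"
proof -
  let ?F = "\<lambda>l s. delta_integral (T l) (\<alpha> l) (\<beta> l) (\<lambda>x. \<psi> l x * s powr x)"
  let ?G = "\<lambda>l s. delta_integral (T l) (\<alpha> l) (\<beta> l) (\<lambda>x. \<phi> l x * s powr x)"
  have pos: "?F l s > 0 \<and> ?G l s > 0" if "l \<in> {1..m}" "s > 0" for l s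
    using assms(2-6)[OF that(1)] that by (intro conjI delta_integral_pos) auto
  have inc: "?F l s / ?G l s \<le> ?F l t / ?G l t"
    if l: "l \<in> {1..m}" and st: "0 < s" "s \<le> t"
      and mono: "mono_on ({\<alpha> l..\<beta> l} \<inter> T l) (\<lambda>x. \<psi> l x / \<phi> l x)" for l s t
    using mono_on_delta_integral_powr_ratio[of "T l" "\<alpha> l" "\<beta> l" "\<phi> l" "\<psi> l"] assms(2-6)[OF l] mono st
    by (auto simp: monotone_on_def)
  \<comment> \<open>A decreasing \<open>\<psi> / \<phi>\<close> has an increasing reciprocal, so the
    increasing case applies with \<open>\<psi>\<close> and \<open>\<phi>\<close> exchanged.
    Positivity of the integrals allows the quotients to be inverted back.\<close>
  have dec: "?F l t / ?G l t \<le> ?F l s / ?G l s"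
    if l: "l \<in> {1..m}" and st: "0 < s" "s \<le> t"
      and anti: "antimono_on ({\<alpha> l..\<beta> l} \<inter> T l) (\<lambda>x. \<psi> l x / \<phi> l x)" for l s t
  proof -
    have "mono_on ({\<alpha> l..\<beta> l} \<inter> T l) (\<lambda>x. \<phi> l x / \<psi> l x)"
    proof (rule mono_onI)
      fix x y assume xy: "x \<in> {\<alpha> l..\<beta> l} \<inter> T l" "y \<in> {\<alpha> l..\<beta> l} \<inter> T l" "x \<le> y"
      then have "\<psi> l y / \<phi> l y \<le> \<psi> l x / \<phi> l x"
        using monotone_onD[OF anti] by blast
      then show "\<phi> l x / \<psi> l x \<le> \<phi> l y / \<psi> l y"
        using assms(4)[OF l xy(1)] assms(4)[OF l xy(2)] by (simp add: field_simps)
    qed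
    then have "?G l s / ?F l s \<le> ?G l t / ?F l t"
      using mono_on_delta_integral_powr_ratio[of "T l" "\<alpha> l" "\<beta> l" "\<psi> l" "\<phi> l"] assms(2-6)[OF l] st
      by (auto simp: monotone_on_def)
    then show ?thesis
      using pos[OF l, of s] pos[OF l, of t] st by (simp add: field_simps)
  qed
  have nonneg: "0 \<le> ?F l s / ?G l s" if "l \<in> {1..m}" "s > 0" for l s
    using pos[OF that] by simp
  show ?thesis
    \<comment> \<open>As a product of quotients, the function can be compared factor by factor,
      since all factors are nonnegative.\<close>
    unfolding prod_dividef[symmetric]
    by (intro conjI impI monotone_onI prod_mono) (use inc dec nonneg in auto)
qed

end
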